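(* Let $d \ge 1$, let $\alpha_1,\dots,\alpha_d$ be positive integers, and let $K_0 = \{x \in \mathbb{R}^d : |x_i| \le \alpha_i \text{ for } 1 \le i \le d\}$. Then there exists $\delta > 0$ such that for every rotation $R \in SO(d)$ satisfying $0 < \|R - I\|_{\mathrm{op}} < \delta$, the rotated box $K_R = R K_0$ satisfies the strict inequality $$G(K_R, \mathbb{Z}^d) < \mathcal{R}(K_R).$$
   Context: For an $o$-symmetric convex body $K \subset \mathbb{R}^d$ (compact, convex, nonempty interior, $K=-K$), the lattice point enumerator is $G(K,\mathbb{Z}^d) = |K \cap \mathbb{Z}^d|$. The successive minima are $\lambda_i(K,\mathbb{Z}^d) = \inf\{\lambda > 0 : \dim(\lambda K \cap \mathbb{Z}^d) \ge i\}$ for $1 \le i \le d$, where $\dim$ of a set denotes the dimension of its linear span. The functional $\mathcal{R}$ (the right-hand side of the Betke-Henk-Wills inequality) is $$\mathcal{R}(K) = \prod_{i=1}^d \left\lfloor \frac{2}{\lambda_i(K,\mathbb{Z}^d)} + 1 \right\rfloor.$$ $I$ is the $d \times d$ identity matrix and $\|\cdot\|_{\mathrm{op}}$ is the operator norm induced by the Euclidean norm on $\mathbb{R}^d$. *)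

theory Defs
  imports "HOL-Analysis.Analysis"
begin

definition integer_lattice :: "(real ^ 'n) set" where
  "integer_lattice = {x. \<forall>i. x $ i \<in> \<int>}"

(* The set counted is finite whenever K is bounded, so card is the genuine cardinality there. *)
definition lattice_point_enumerator :: "(real ^ 'n) set \<Rightarrow> nat" where
  "lattice_point_enumerator K = card (K \<inter> integer_lattice)"

(* dim is the dimension of the linear span. Meant for 1 <= i <= CARD('n) and K an o-symmetric
   convex body, where the infimum is over a nonempty set of positive reals. *)
definition successive_minimum :: "(real ^ 'n) set \<Rightarrow> nat \<Rightarrow> real" where
  "successive_minimum K i =
     Inf {t :: real. t > 0 \<and> dim (((*\<^sub>R) t ` K) \<inter> integer_lattice) \<ge> i}"

definition BHW_bound :: "(real ^ 'n) set \<Rightarrow> int" where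
  "BHW_bound K = (\<Prod>i = 1..CARD('n). \<lfloor>2 / successive_minimum K i + 1\<rfloor>)"

end

theory Submission
  imports Defs
begin

text \<open>
  For the unrotated box both sides equal \<open>\<Prod>i. (2 * \<alpha> i + 1)\<close>. A small nontrivial rotation
  lowers the left side and does not lower the right side.

  Left side. A rotation close to the identity displaces the points of the box by less than 1, and
  the half-lengths \<open>\<alpha> i\<close> are integers, so no new lattice point enters
  (\<open>lattice_points_rotated_box_subset\<close>). Some vertex leaves
  (\<open>rotated_box_misses_vertex\<close>): the vertices are the points of the box that are farthest from
  the origin, so a vertex that stays in the rotated box is the image of a vertex, and by the small
  displacement of itself; a rotation fixing all vertices is the identity, because the vertices
  span the space.

  Right side. The diagonal entries of an orthogonal matrix are at most 1 in absolute value, while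
  the other entries are small for a matrix close to the identity. Hence the unit vector along axis
  \<open>k\<close> still lies in the rotated box scaled by \<open>1 / \<alpha> k\<close>
  (\<open>axis_in_scaled_rotated_box\<close>). No successive minimum increases, and each factor of the
  right side stays at least \<open>2 * \<alpha> k + 1\<close> (\<open>BHW_bound_ge_box\<close>).
\<close>

section \<open>Boxes\<close>

definition box_body :: "('n::finite \<Rightarrow> nat) \<Rightarrow> (real ^ 'n) set" where
  "box_body \<alpha> = {x. \<forall>i. \<bar>x $ i\<bar> \<le> real (\<alpha> i)}"

lemma norm_le_in_box_body:
  fixes x :: "real ^ 'n::finite"
  assumes "x \<in> box_body \<alpha>"
  shows "norm x \<le> real (\<Sum>i\<in>UNIV. \<alpha> i)"
proof -
  have "norm x \<le> (\<Sum>i\<in>UNIV. \<bar>x $ i\<bar>)" by (rule norm_le_l1_cart)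
  also have "\<dots> \<le> (\<Sum>i\<in>UNIV. real (\<alpha> i))"
    using assms by (intro sum_mono) (auto simp: box_body_def)
  finally show ?thesis by simp
qed

lemma bij_betw_lattice_points_box_body:
  fixes \<alpha> :: "'n::finite \<Rightarrow> nat"
  shows "bij_betw (\<lambda>g. \<chi> i. real_of_int (g i)) (PiE UNIV (\<lambda>i. {- int (\<alpha> i)..int (\<alpha> i)}))
           (box_body \<alpha> \<inter> integer_lattice)"
proof (rule bij_betwI')
  fix y :: "real ^ 'n"
  assume y: "y \<in> box_body \<alpha> \<inter> integer_lattice"
  define g where "g = (\<lambda>i. \<lfloor>y $ i\<rfloor>)"
  have g: "real_of_int (g i) = y $ i" for i
    using y by (auto simp: integer_lattice_def g_def)
  have "- int (\<alpha> i) \<le> g i \<and> g i \<le> int (\<alpha> i)" for i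
  proof -
    have "\<bar>real_of_int (g i)\<bar> \<le> real (\<alpha> i)"
      using y by (auto simp: g box_body_def)
    thus ?thesis by linarith
  qed
  moreover have "y = (\<chi> i. real_of_int (g i))" by (simp add: g vec_eq_iff)
  ultimately show "\<exists>g\<in>PiE UNIV (\<lambda>i. {- int (\<alpha> i)..int (\<alpha> i)}). y = (\<chi> i. real_of_int (g i))"
    by (intro bexI[of _ g]) auto
next
  fix g assume g: "g \<in> PiE UNIV (\<lambda>i. {- int (\<alpha> i)..int (\<alpha> i)})"
  have "\<bar>real_of_int (g i)\<bar> \<le> real (\<alpha> i)" for i
  proof -
    have "\<bar>g i\<bar> \<le> int (\<alpha> i)" using PiE_mem[OF g, of i] by (auto simp: abs_le_iff)
    thus ?thesis by linarith
  qed
  thus "(\<chi> i. real_of_int (g i)) \<in> box_body \<alpha> \<inter> integer_lattice"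
    by (auto simp: box_body_def integer_lattice_def)
qed (auto simp: vec_eq_iff)

lemma lattice_point_enumerator_box_body:
  fixes \<alpha> :: "'n::finite \<Rightarrow> nat"
  shows "finite (box_body \<alpha> \<inter> integer_lattice)"
    and "lattice_point_enumerator (box_body \<alpha>) = (\<Prod>i\<in>UNIV. 2 * \<alpha> i + 1)"
proof -
  note b = bij_betw_lattice_points_box_body[of \<alpha>]
  show "finite (box_body \<alpha> \<inter> integer_lattice)"
    using bij_betw_finite[OF b] by (auto intro!: finite_PiE)
  have "lattice_point_enumerator (box_body \<alpha>) = card (PiE UNIV (\<lambda>i. {- int (\<alpha> i)..int (\<alpha> i)}))"
    using bij_betw_same_card[OF b] by (simp add: lattice_point_enumerator_def)
  also have "\<dots> = (\<Prod>i\<in>UNIV. 2 * \<alpha> i + 1)"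
    by (subst card_PiE) (auto intro!: prod.cong)
  finally show "lattice_point_enumerator (box_body \<alpha>) = (\<Prod>i\<in>UNIV. 2 * \<alpha> i + 1)" .
qed

section \<open>Successive minima\<close>

lemma norm_ge_1_integer_lattice:
  fixes x :: "real ^ 'n::finite"
  assumes "x \<in> integer_lattice" "x \<noteq> 0"
  shows "1 \<le> norm x"
proof -
  obtain i where i: "x $ i \<noteq> 0" using assms(2) by (auto simp: vec_eq_iff)
  moreover have "x $ i \<in> \<int>" using assms(1) by (simp add: integer_lattice_def)
  ultimately have "1 \<le> \<bar>x $ i\<bar>" by (rule Ints_nonzero_abs_ge1[rotated])
  thus ?thesis using component_le_norm_cart[of x i] by linarith
qed

text \<open>
  Positivity matters as much as the upper bound: with division by zero giving 0, an upper bound on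
  a minimum says something about \<open>2 / successive_minimum K i\<close> only if the minimum is positive. It is
  positive because a nonzero lattice vector has norm at least 1, so that no dilate of \<open>K\<close> by less
  than \<open>1 / B\<close> contains one.
\<close>
lemma successive_minimum_bounds:
  fixes K :: "(real ^ 'n::finite) set"
  assumes bound: "\<And>x. x \<in> K \<Longrightarrow> norm x \<le> B"
    and i: "1 \<le> i" and t: "0 < t" and dim: "i \<le> dim (((*\<^sub>R) t ` K) \<inter> integer_lattice)"
  shows "0 < successive_minimum K i" and "successive_minimum K i \<le> t"
proof -
  define S where "S = {t :: real. t > 0 \<and> dim (((*\<^sub>R) t ` K) \<inter> integer_lattice) \<ge> i}"
  have lower: "0 < B \<and> 1 / B \<le> s" if "s \<in> S" for s
  proof -
    have s: "0 < s" "i \<le> dim (((*\<^sub>R) s ` K) \<inter> integer_lattice)"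
      using that unfolding S_def by blast+
    have "\<not> ((*\<^sub>R) s ` K) \<inter> integer_lattice \<subseteq> {0}"
      using s(2) i dim_eq_0[of "((*\<^sub>R) s ` K) \<inter> integer_lattice"] by linarith
    then obtain y where "y \<in> ((*\<^sub>R) s ` K) \<inter> integer_lattice" "y \<noteq> 0" by blast
    then obtain x where x: "x \<in> K" "1 \<le> norm (s *\<^sub>R x)"
      using norm_ge_1_integer_lattice by blast
    have "1 \<le> s * norm x" using x s by simp
    also have "\<dots> \<le> s * B" using bound[OF x(1)] s by simp
    finally have 1: "1 \<le> s * B" .
    hence "0 < B" using s by (smt (verit) mult_nonneg_nonpos)
    thus ?thesis using 1 by (simp add: field_simps)
  qed
  have tS: "t \<in> S" using t dim by (simp add: S_def)
  have "0 < 1 / B" using lower[OF tS] by simp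
  also have "1 / B \<le> Inf S" using tS lower by (intro cInf_greatest) auto
  finally show "0 < successive_minimum K i" by (simp add: successive_minimum_def S_def)
  have "Inf S \<le> t" using tS lower by (intro cInf_lower bdd_belowI[of _ "1/B"]) auto
  thus "successive_minimum K i \<le> t" by (simp add: successive_minimum_def S_def)
qed

text \<open>
  Successive minima are indexed by size and the half-lengths by coordinates; listing the
  coordinates from the longest side to the shortest matches the two.
\<close>
lemma decreasing_enumeration:
  fixes \<alpha> :: "'n::finite \<Rightarrow> nat"
  obtains f :: "nat \<Rightarrow> 'n" where "bij_betw f {1..CARD('n)} UNIV"
    and "\<And>i j. 1 \<le> i \<Longrightarrow> i \<le> j \<Longrightarrow> j \<le> CARD('n) \<Longrightarrow> \<alpha> (f j) \<le> \<alpha> (f i)"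
proof -
  obtain xs :: "'n list" where xs: "set xs = UNIV" "distinct xs"
    using finite_distinct_list[OF finite] by blast
  define ys where "ys = sort_key (\<lambda>i. - int (\<alpha> i)) xs"
  have ys: "set ys = UNIV" "distinct ys" using xs by (auto simp: ys_def)
  have len: "length ys = CARD('n)" using distinct_card[OF ys(2)] ys(1) by simp
  have sorted: "sorted (map (\<lambda>i. - int (\<alpha> i)) ys)" by (simp add: ys_def)
  have "bij_betw ((!) ys) {..<CARD('n)} UNIV"
    by (rule bij_betw_nth[OF ys(2)]) (simp_all add: ys(1) len)
  moreover have "bij_betw (\<lambda>i. i - 1) {1..CARD('n)} {..<CARD('n)}"
    by (rule bij_betw_byWitness[where f' = Suc]) auto
  ultimately have "bij_betw ((!) ys \<circ> (\<lambda>i. i - 1)) {1..CARD('n)} UNIV"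
    by (rule bij_betw_trans[rotated])
  moreover have "\<alpha> (ys ! (j - 1)) \<le> \<alpha> (ys ! (i - 1))"
    if "1 \<le> i" "i \<le> j" "j \<le> CARD('n)" for i j
  proof -
    have "i - 1 \<le> j - 1" "j - 1 < length ys" using that len by auto
    thus ?thesis using sorted_nth_mono[OF sorted, of "i - 1" "j - 1"] by simp
  qed
  ultimately show thesis by (intro that[of "(!) ys \<circ> (\<lambda>i. i - 1)"]) auto
qed

text \<open>
  After sorting, the dilate of \<open>K\<close> by the reciprocal of the \<open>i\<close>-th largest half-length contains the
  unit vectors along the \<open>i\<close> longest sides, which bounds the \<open>i\<close>-th minimum by that reciprocal.
  The axis assumption ranges over all \<open>m \<le> \<alpha> k\<close> because the dilate is determined by the
  shortest of these \<open>i\<close> sides and must contain the unit vectors of the longer ones too.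
\<close>
lemma BHW_bound_ge_box:
  fixes \<alpha> :: "'n::finite \<Rightarrow> nat" and K :: "(real ^ 'n) set"
  assumes pos: "\<And>i. 0 < \<alpha> i" and bound: "\<And>x. x \<in> K \<Longrightarrow> norm x \<le> B"
    and axes: "\<And>m k. 0 < m \<Longrightarrow> m \<le> \<alpha> k \<Longrightarrow> axis k 1 \<in> (*\<^sub>R) (1 / real m) ` K"
  shows "int (\<Prod>i\<in>UNIV. 2 * \<alpha> i + 1) \<le> BHW_bound K"
proof -
  obtain f where f: "bij_betw f {1..CARD('n)} (UNIV :: 'n set)"
    and mono: "\<And>i j. 1 \<le> i \<Longrightarrow> i \<le> j \<Longrightarrow> j \<le> CARD('n) \<Longrightarrow> \<alpha> (f j) \<le> \<alpha> (f i)"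
    using decreasing_enumeration[of \<alpha>] by blast
  have factor: "int (2 * \<alpha> (f i) + 1) \<le> \<lfloor>2 / successive_minimum K i + 1\<rfloor>"
    if i: "i \<in> {1..CARD('n)}" for i
  proof -
    define t where "t = 1 / real (\<alpha> (f i))"
    have t: "0 < t" using pos by (simp add: t_def)
    define E where "E = (\<lambda>j. axis (f j) (1::real)) ` {1..i}"
    have "inj_on (\<lambda>j. axis (f j) (1::real)) {1..i}"
    proof (rule inj_onI)
      fix a b assume ab: "a \<in> {1..i}" "b \<in> {1..i}" "axis (f a) (1::real) = axis (f b) 1"
      have "f a = f b" using ab(3) by (simp add: axis_eq_axis)
      moreover have "a \<in> {1..CARD('n)}" "b \<in> {1..CARD('n)}" using ab i by simp_all
      ultimately show "a = b" using bij_betw_imp_inj_on[OF f] by (simp only: inj_on_eq_iff)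
    qed
    hence "card E = i" by (simp add: E_def card_image)
    moreover have "independent E"
      by (rule independent_mono[OF independent_Basis]) (auto simp: E_def)
    moreover have "E \<subseteq> ((*\<^sub>R) t ` K) \<inter> integer_lattice"
    proof
      fix e assume "e \<in> E"
      then obtain j where j: "1 \<le> j" "j \<le> i" "e = axis (f j) 1" by (auto simp: E_def)
      have "e \<in> (*\<^sub>R) t ` K"
        unfolding t_def j(3) using pos mono[of j i] i j by (intro axes) auto
      moreover have "e \<in> integer_lattice" by (simp add: j(3) integer_lattice_def axis_def)
      ultimately show "e \<in> ((*\<^sub>R) t ` K) \<inter> integer_lattice" by blast
    qed
    ultimately have "i \<le> dim (((*\<^sub>R) t ` K) \<inter> integer_lattice)"
      by (metis independent_card_le_dim)
    from successive_minimum_bounds[OF bound _ t this] i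
    have lam: "0 < successive_minimum K i" "successive_minimum K i \<le> t" by auto
    have "2 * real (\<alpha> (f i)) = 2 / t" by (simp add: t_def)
    also have "\<dots> \<le> 2 / successive_minimum K i"
      using lam by (intro divide_left_mono) auto
    finally show ?thesis by (simp add: le_floor_iff)
  qed
  have "int (\<Prod>i\<in>UNIV. 2 * \<alpha> i + 1) = (\<Prod>i\<in>UNIV. int (2 * \<alpha> i + 1))"
    by (simp only: of_nat_prod)
  also have "\<dots> = (\<Prod>i = 1..CARD('n). int (2 * \<alpha> (f i) + 1))"
    using prod.reindex_bij_betw[OF f, of "\<lambda>k. int (2 * \<alpha> k + 1)"] by simp
  also have "\<dots> \<le> BHW_bound K"
    unfolding BHW_bound_def by (intro prod_mono conjI of_nat_0_le_iff factor)
  finally show ?thesis .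
qed

section \<open>Small rotations of the box\<close>

lemma norm_orthogonal_matrix_mult:
  fixes R :: "real ^ 'n::finite ^ 'n"
  assumes "orthogonal_matrix R"
  shows "norm (R *v x) = norm x"
  using assms orthogonal_transformation_matrix[of "(*v) R"]
  by (simp add: orthogonal_transformation_norm)

lemma component_diff_le_onorm:
  fixes R :: "real ^ 'n::finite ^ 'n"
  shows "\<bar>(R *v x) $ i - x $ i\<bar> \<le> onorm ((*v) (R - mat 1)) * norm x"
proof -
  have "\<bar>(R *v x) $ i - x $ i\<bar> = \<bar>((R - mat 1) *v x) $ i\<bar>"
    by (simp add: matrix_vector_mult_diff_rdistrib)
  also have "\<dots> \<le> norm ((R - mat 1) *v x)" by (rule component_le_norm_cart)
  also have "\<dots> \<le> onorm ((*v) (R - mat 1)) * norm x"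
    by (intro onorm matrix_vector_mul_bounded_linear)
  finally show ?thesis .
qed

lemma box_displacement_less_1:
  fixes R :: "real ^ 'n::finite ^ 'n" and \<alpha> :: "'n \<Rightarrow> nat"
  assumes small: "onorm ((*v) (R - mat 1)) * real (\<Sum>i\<in>UNIV. \<alpha> i) < 1"
    and x: "x \<in> box_body \<alpha>"
  shows "\<bar>(R *v x) $ i - x $ i\<bar> < 1"
proof -
  have "\<bar>(R *v x) $ i - x $ i\<bar> \<le> onorm ((*v) (R - mat 1)) * norm x"
    by (rule component_diff_le_onorm)
  also have "\<dots> \<le> onorm ((*v) (R - mat 1)) * real (\<Sum>i\<in>UNIV. \<alpha> i)"
    by (intro mult_left_mono norm_le_in_box_body x onorm_pos_le matrix_vector_mul_bounded_linear)
  also note small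
  finally show ?thesis .
qed

text \<open>
  Membership says that row \<open>k\<close> of \<open>R\<close>, scaled by \<open>m\<close>, lies in the box. The diagonal entry is
  controlled by orthogonality alone, which gives the sharp bound \<open>\<alpha> k\<close>; a bound
  from closeness to the identity would exceed it slightly, which could cost a unit in the floor.
  Closeness to the identity bounds the other entries, where there is room to spare.
\<close>
lemma axis_in_scaled_rotated_box:
  fixes R :: "real ^ 'n::finite ^ 'n" and \<alpha> :: "'n \<Rightarrow> nat"
  assumes orth: "orthogonal_matrix R" and pos: "\<And>i. 0 < \<alpha> i"
    and small: "onorm ((*v) (R - mat 1)) * real (\<alpha> k) \<le> 1"
    and m: "0 < m" "m \<le> \<alpha> k"
  shows "axis k 1 \<in> (*\<^sub>R) (1 / real m) ` ((*v) R ` box_body \<alpha>)"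
proof -
  \<comment> \<open>The preimage of the axis vector under the scaled rotation.\<close>
  define x where "x = real m *\<^sub>R (transpose R *v axis k 1)"
  have xj: "x $ j = real m * R $ k $ j" for j
    by (simp add: x_def matrix_vector_mul_component inner_axis' transpose_def inner_axis)
  have col: "R $ k $ j = (R *v axis j 1) $ k" for j
    by (simp add: matrix_vector_mul_component inner_axis)
  have "\<bar>x $ j\<bar> \<le> real (\<alpha> j)" for j
  proof (cases "j = k")
    case True
    have "\<bar>R $ k $ j\<bar> \<le> norm (R *v axis j 1)" unfolding col by (rule component_le_norm_cart)
    hence "\<bar>R $ k $ j\<bar> \<le> 1" by (simp add: norm_orthogonal_matrix_mult[OF orth])
    hence "real m * \<bar>R $ k $ j\<bar> \<le> real (\<alpha> k) * 1" using m by (intro mult_mono) auto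
    thus ?thesis using True by (simp add: xj abs_mult)
  next
    case False
    have "\<bar>R $ k $ j\<bar> \<le> onorm ((*v) (R - mat 1))"
      using component_diff_le_onorm[of R "axis j 1" k] False by (simp add: col) (simp add: axis_def)
    hence "real m * \<bar>R $ k $ j\<bar> \<le> real (\<alpha> k) * onorm ((*v) (R - mat 1))"
      using m by (intro mult_mono) auto
    also have "\<dots> \<le> 1" using small by (simp add: mult.commute)
    also have "1 \<le> real (\<alpha> j)" using pos[of j] by simp
    finally show ?thesis by (simp add: xj abs_mult)
  qed
  hence "x \<in> box_body \<alpha>" by (simp add: box_body_def)
  moreover have "axis k 1 = (1 / real m) *\<^sub>R (R *v x)"
  proof -
    have "R *v (transpose R *v axis k 1) = axis k 1"
      using orth by (simp only: matrix_vector_mul_assoc orthogonal_matrix_def matrix_vector_mul_lid)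
    thus ?thesis using m by (simp add: x_def matrix_vector_mult_scaleR del: transpose_matrix_vector)
  qed
  ultimately show ?thesis by blast
qed

lemma lattice_points_rotated_box_subset:
  fixes R :: "real ^ 'n::finite ^ 'n" and \<alpha> :: "'n \<Rightarrow> nat"
  assumes small: "onorm ((*v) (R - mat 1)) * real (\<Sum>i\<in>UNIV. \<alpha> i) < 1"
  shows "(*v) R ` box_body \<alpha> \<inter> integer_lattice \<subseteq> box_body \<alpha> \<inter> integer_lattice"
proof
  fix y assume y: "y \<in> (*v) R ` box_body \<alpha> \<inter> integer_lattice"
  then obtain x where x: "x \<in> box_body \<alpha>" "y = R *v x" by blast
  have "\<bar>y $ i\<bar> \<le> real (\<alpha> i)" for i
  proof -
    have "\<bar>y $ i - x $ i\<bar> < 1"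
      using box_displacement_less_1[OF small x(1)] by (simp add: x(2))
    hence "\<bar>y $ i\<bar> < real (\<alpha> i) + 1" using x(1) by (auto simp: box_body_def dest!: spec[of _ i])
    moreover obtain z where z: "y $ i = real_of_int z"
      using y by (auto simp: integer_lattice_def elim: Ints_cases)
    ultimately have "\<bar>z\<bar> \<le> int (\<alpha> i)" by linarith
    thus ?thesis unfolding z by linarith
  qed
  thus "y \<in> box_body \<alpha> \<inter> integer_lattice" using y by (simp add: box_body_def)
qed

text \<open>
  The preimage of the vertex has the same norm, but none of its coordinates exceeds that of the
  vertex in absolute value, so all agree in absolute value. A sign change would
  displace a coordinate by \<open>2 * \<alpha> i \<ge> 2\<close>, which the small rotation cannot do.
\<close>
lemma vertex_fixed:
  fixes R :: "real ^ 'n::finite ^ 'n" and \<alpha> :: "'n \<Rightarrow> nat"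
  assumes orth: "orthogonal_matrix R" and pos: "\<And>i. 0 < \<alpha> i"
    and small: "onorm ((*v) (R - mat 1)) * real (\<Sum>i\<in>UNIV. \<alpha> i) < 1"
    and v: "\<And>i. \<bar>v $ i\<bar> = real (\<alpha> i)" and mem: "v \<in> (*v) R ` box_body \<alpha>"
  shows "R *v v = v"
proof -
  obtain x where x: "x \<in> box_body \<alpha>" "v = R *v x" using mem by blast
  have le: "(x $ i)\<^sup>2 \<le> (v $ i)\<^sup>2" for i
    using x(1) by (simp add: abs_le_square_iff[symmetric] v box_body_def)
  have "norm x = norm v" using norm_orthogonal_matrix_mult[OF orth] x(2) by simp
  hence "x \<bullet> x = v \<bullet> v" by (simp add: norm_eq)
  hence "(\<Sum>i\<in>UNIV. (x $ i)\<^sup>2) = (\<Sum>i\<in>UNIV. (v $ i)\<^sup>2)"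
    by (simp add: inner_vec_def power2_eq_square)
  hence "(x $ i)\<^sup>2 = (v $ i)\<^sup>2" for i
    using sum_mono_inv[of "\<lambda>i. (x $ i)\<^sup>2" UNIV "\<lambda>i. (v $ i)\<^sup>2" i] le by simp
  hence same: "x $ i = v $ i \<or> x $ i = - v $ i" for i by (simp add: power2_eq_iff)
  have "x $ i = v $ i" for i
  proof -
    have "\<bar>v $ i - x $ i\<bar> < 1"
      using box_displacement_less_1[OF small x(1)] by (simp add: x(2))
    thus ?thesis using same[of i] v[of i] pos[of i] by linarith
  qed
  hence "x = v" by (simp add: vec_eq_iff)
  thus ?thesis using x by simp
qed

text \<open>
  Otherwise every vertex is fixed, and so is the difference of two adjacent vertices, which is a
  nonzero multiple of a unit vector.
\<close>
lemma rotated_box_misses_vertex: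
  fixes R :: "real ^ 'n::finite ^ 'n" and \<alpha> :: "'n \<Rightarrow> nat"
  assumes orth: "orthogonal_matrix R" and pos: "\<And>i. 0 < \<alpha> i"
    and small: "onorm ((*v) (R - mat 1)) * real (\<Sum>i\<in>UNIV. \<alpha> i) < 1"
    and "R \<noteq> mat 1"
  shows "\<exists>v. (\<forall>i. \<bar>v $ i\<bar> = real (\<alpha> i)) \<and> v \<in> integer_lattice \<and> v \<notin> (*v) R ` box_body \<alpha>"
proof (rule ccontr)
  assume contra: "\<not> ?thesis"
  have fixed: "R *v v = v" if v: "\<And>i. v $ i = real (\<alpha> i) \<or> v $ i = - real (\<alpha> i)" for v
  proof -
    have abs: "\<bar>v $ i\<bar> = real (\<alpha> i)" for i using v[of i] by auto
    have "v $ i \<in> \<int>" for i using v[of i] by auto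
    hence "v \<in> integer_lattice" by (simp add: integer_lattice_def)
    with contra abs have "v \<in> (*v) R ` box_body \<alpha>" by blast
    with vertex_fixed[OF orth pos small] abs show ?thesis by blast
  qed
  define p :: "real ^ 'n" where "p = (\<chi> i. real (\<alpha> i))"
  define q :: "'n \<Rightarrow> real ^ 'n" where "q k = (\<chi> i. if i = k then - real (\<alpha> i) else real (\<alpha> i))" for k
  have "R *v axis k 1 = axis k 1" for k
  proof -
    have pq: "p - q k = (2 * real (\<alpha> k)) *\<^sub>R axis k 1"
      by (simp add: p_def q_def vec_eq_iff axis_def)
    have "R *v (p - q k) = p - q k"
      using fixed[of p] fixed[of "q k"]
      by (simp add: p_def q_def matrix_vector_mult_diff_distrib)
    thus ?thesis using pos[of k] by (simp add: pq matrix_vector_mult_scaleR)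
  qed
  hence "R = mat 1"
    by (metis matrix_vector_mul_lid matrix_vector_mul_component vec_eq_iff inner_axis cart_eq_inner_axis)
  with \<open>R \<noteq> mat 1\<close> show False ..
qed

theorem theorem4:
  fixes \<alpha> :: "'n::finite \<Rightarrow> nat" and K0 :: "(real ^ 'n) set"
  assumes "\<And>i. \<alpha> i > 0"
    and "K0 = {x. \<forall>i. \<bar>x $ i\<bar> \<le> real (\<alpha> i)}"
  shows "\<exists>\<delta>>0. \<forall>R :: real ^ 'n ^ 'n.
           rotation_matrix R \<and>
           0 < onorm ((*v) (R - mat 1)) \<and> onorm ((*v) (R - mat 1)) < \<delta> \<longrightarrow>
           int (lattice_point_enumerator ((*v) R ` K0)) < BHW_bound ((*v) R ` K0)"
proof -
  have K0: "K0 = box_body \<alpha>" using assms(2) by (simp add: box_body_def)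
  define s where "s = real (\<Sum>i\<in>UNIV. \<alpha> i)"
  have \<alpha>_le_s: "real (\<alpha> k) \<le> s" for k
    unfolding s_def of_nat_le_iff by (rule member_le_sum) auto
  have s: "0 < s" using \<alpha>_le_s[of undefined] assms(1)[of undefined] by linarith
  show ?thesis
  proof (intro exI[of _ "1 / s"] conjI allI impI)
    show "0 < 1 / s" using s by simp
  next
    fix R :: "real ^ 'n ^ 'n"
    assume R: "rotation_matrix R \<and> 0 < onorm ((*v) (R - mat 1)) \<and> onorm ((*v) (R - mat 1)) < 1 / s"
    let ?K = "(*v) R ` box_body \<alpha>"
    have orth: "orthogonal_matrix R" using R by (simp add: rotation_matrix_def)
    have small: "onorm ((*v) (R - mat 1)) * s < 1" using R s by (simp add: field_simps)
    have "R \<noteq> mat 1"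
    proof
      assume "R = mat 1"
      hence "(*v) (R - mat 1) = (\<lambda>x. 0)" by (simp add: fun_eq_iff)
      with R show False by (simp add: onorm_zero)
    qed
    then obtain v where v: "\<And>i. \<bar>v $ i\<bar> = real (\<alpha> i)" "v \<in> integer_lattice" "v \<notin> ?K"
      using rotated_box_misses_vertex[OF orth assms(1) small[unfolded s_def]] by blast
    have "?K \<inter> integer_lattice \<subset> box_body \<alpha> \<inter> integer_lattice"
      using lattice_points_rotated_box_subset[OF small[unfolded s_def]] v
      by (auto simp: box_body_def)
    hence "lattice_point_enumerator ?K < lattice_point_enumerator (box_body \<alpha>)"
      unfolding lattice_point_enumerator_def
      by (intro psubset_card_mono lattice_point_enumerator_box_body)
    also have "\<dots> = (\<Prod>i\<in>UNIV. 2 * \<alpha> i + 1)" by (rule lattice_point_enumerator_box_body)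
    finally have "int (lattice_point_enumerator ?K) < int (\<Prod>i\<in>UNIV. 2 * \<alpha> i + 1)"
      by (simp only: of_nat_less_iff)
    also have "\<dots> \<le> BHW_bound ?K"
    proof (rule BHW_bound_ge_box[where B = s])
      show "norm x \<le> s" if "x \<in> ?K" for x
        using that norm_le_in_box_body by (auto simp: s_def norm_orthogonal_matrix_mult[OF orth])
    next
      fix m :: nat and k assume m: "0 < m" "m \<le> \<alpha> k"
      have "onorm ((*v) (R - mat 1)) * real (\<alpha> k) \<le> onorm ((*v) (R - mat 1)) * s"
        using R \<alpha>_le_s by (intro mult_left_mono) auto
      with small have "onorm ((*v) (R - mat 1)) * real (\<alpha> k) \<le> 1" by linarith
      thus "axis k 1 \<in> (*\<^sub>R) (1 / real m) ` ?K"
        using orth assms(1) m by (intro axis_in_scaled_rotated_box)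
    qed (rule assms(1))
    finally show "int (lattice_point_enumerator ((*v) R ` K0)) < BHW_bound ((*v) R ` K0)"
      unfolding K0 .
  qed
qed

end
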